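(* Suppose the affine control system $\dot{\boldsymbol{x}}(t)=\boldsymbol{R}(\boldsymbol{x}(t))+\boldsymbol{\mathcal{B}}(\boldsymbol{x}(t))\boldsymbol{u}(t)$ with output $\boldsymbol{y}(t)$ satisfies the linearizing assumption with constant projectors $\boldsymbol{\mathcal{P}},\boldsymbol{\mathcal{Q}}$ and constant state matrix $\boldsymbol{\mathcal{A}}$. If the $n\times n^2$ controllability matrix $$\boldsymbol{\mathcal{K}}=\left(\boldsymbol{\mathcal{Q}}\boldsymbol{\mathcal{A}}\boldsymbol{\mathcal{P}}\,|\,\boldsymbol{\mathcal{Q}}\boldsymbol{\mathcal{A}}\boldsymbol{\mathcal{Q}}\boldsymbol{\mathcal{A}}\boldsymbol{\mathcal{P}}\,|\,\cdots\,|\,(\boldsymbol{\mathcal{Q}}\boldsymbol{\mathcal{A}}\boldsymbol{\mathcal{Q}})^{n-1}\boldsymbol{\mathcal{Q}}\boldsymbol{\mathcal{A}}\boldsymbol{\mathcal{P}}\right)$$ (the blocks being $(\boldsymbol{\mathcal{Q}}\boldsymbol{\mathcal{A}}\boldsymbol{\mathcal{Q}})^{k}\boldsymbol{\mathcal{Q}}\boldsymbol{\mathcal{A}}\boldsymbol{\mathcal{P}}$ for $k=0,\dots,n-1$) satisfies the rank condition $\operatorname{rank}(\boldsymbol{\mathcal{K}})=n-p$, then the system is controllable.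
   Context: Let $1\le p\le n$, $m\le n$, $\boldsymbol{x}(t)\in\mathbb{R}^n$ (state), $\boldsymbol{u}(t)\in\mathbb{R}^p$ (control signal), $\boldsymbol{y}(t)\in\mathbb{R}^m$ (output), $\boldsymbol{R}:\mathbb{R}^n\to\mathbb{R}^n$, and let $\boldsymbol{\mathcal{B}}(\boldsymbol{x})$ be a real $n\times p$ matrix depending on $\boldsymbol{x}\in\mathbb{R}^n$ with $\operatorname{rank}\boldsymbol{\mathcal{B}}(\boldsymbol{x})=p$ for all $\boldsymbol{x}$. Define $\boldsymbol{\mathcal{B}}^{+}(\boldsymbol{x})=\left(\boldsymbol{\mathcal{B}}^T(\boldsymbol{x})\boldsymbol{\mathcal{B}}(\boldsymbol{x})\right)^{-1}\boldsymbol{\mathcal{B}}^T(\boldsymbol{x})$ and the $n\times n$ projectors $\boldsymbol{\mathcal{P}}(\boldsymbol{x})=\boldsymbol{\mathcal{B}}(\boldsymbol{x})\boldsymbol{\mathcal{B}}^{+}(\boldsymbol{x})$, $\boldsymbol{\mathcal{Q}}(\boldsymbol{x})=\boldsymbol{1}-\boldsymbol{\mathcal{P}}(\boldsymbol{x})$. Linearizing assumption: (i) the projectors are independent of the state, $\boldsymbol{\mathcal{P}}(\boldsymbol{x})=\boldsymbol{\mathcal{P}}$ and $\boldsymbol{\mathcal{Q}}(\boldsymbol{x})=\boldsymbol{\mathcal{Q}}=\boldsymbol{1}-\boldsymbol{\mathcal{P}}$ for all $\boldsymbol{x}$; (ii) there are an $n\times n$ matrix $\boldsymbol{\mathcal{A}}$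 and a vector $\boldsymbol{b}\in\mathbb{R}^n$, both independent of the state, with $\boldsymbol{\mathcal{Q}}\boldsymbol{R}(\boldsymbol{x})=\boldsymbol{\mathcal{Q}}\boldsymbol{\mathcal{A}}\boldsymbol{x}+\boldsymbol{\mathcal{Q}}\boldsymbol{b}$ for all $\boldsymbol{x}$; (iii) the output relation is linear, $\boldsymbol{y}(t)=\boldsymbol{\mathcal{C}}\boldsymbol{x}(t)$ with a constant $m\times n$ matrix $\boldsymbol{\mathcal{C}}$ of rank $m$. Controllable (full state controllable): for initial and terminal times $t_0<t_1$ and any states $\boldsymbol{x}_0,\boldsymbol{x}_1\in\mathbb{R}^n$, there exist a control signal $\boldsymbol{u}:[t_0,t_1]\to\mathbb{R}^p$ and a corresponding solution $\boldsymbol{x}$ of the controlled state equation with $\boldsymbol{x}(t_0)=\boldsymbol{x}_0$ and $\boldsymbol{x}(t_1)=\boldsymbol{x}_1$; the trajectory along which the transfer is achieved is irrelevant. *)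

theory Defs
  imports "HOL-Analysis.Analysis"
begin

definition left_pinv :: "real^'p^'n \<Rightarrow> real^'n^'p" where
  "left_pinv B = matrix_inv (transpose B ** B) ** transpose B"

definition proj_P :: "(real^'n \<Rightarrow> real^'p^'n) \<Rightarrow> real^'n \<Rightarrow> real^'n^'n" where
  "proj_P B x = B x ** left_pinv (B x)"

definition proj_Q :: "(real^'n \<Rightarrow> real^'p^'n) \<Rightarrow> real^'n \<Rightarrow> real^'n^'n" where
  "proj_Q B x = mat 1 - proj_P B x"

text \<open>The function \<open>h\<close> is the output map: the output of the system is \<open>y t = h (x t)\<close>.\<close>

definition linearizing_assumption ::
  "(real^'n \<Rightarrow> real^'n) \<Rightarrow> (real^'n \<Rightarrow> real^'p^'n) \<Rightarrow> (real^'n \<Rightarrow> real^'m) \<Rightarrow>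
   real^'n^'n \<Rightarrow> real^'n^'n \<Rightarrow> real^'n^'n \<Rightarrow> real^'n \<Rightarrow> real^'n^'m \<Rightarrow> bool" where
  "linearizing_assumption R B h P Q A b C \<longleftrightarrow>
     (\<forall>x. proj_P B x = P) \<and> (\<forall>x. proj_Q B x = Q) \<and> Q = mat 1 - P \<and>
     (\<forall>x. Q *v R x = (Q ** A) *v x + Q *v b) \<and>
     (\<forall>x. h x = C *v x) \<and> rank C = CARD('m)"

text \<open>Powers with respect to the matrix product; the class operation \<open>M ^ k\<close> on vectors
  and matrices is componentwise.\<close>

definition matpow :: "real^'n^'n \<Rightarrow> nat \<Rightarrow> real^'n^'n" where
  "matpow M k = (((**) M) ^^ k) (mat 1)"

text \<open>The columns of the \<open>n \<times> n\<^sup>2\<close> matrix are indexed by pairs of a block index and a column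
  within that block. Block indices range over \<open>'n\<close>, identified with \<open>0, \<dots>, n - 1\<close> by the
  bijection \<^term>\<open>to_nat_on UNIV\<close>; lemma \<open>columns_controllability_matrix\<close> shows that the
  choice of this bijection does not affect the set of columns.\<close>

definition controllability_matrix ::
  "real^'n^'n \<Rightarrow> real^'n^'n \<Rightarrow> real^'n^'n \<Rightarrow> real^('n \<times> 'n)^'n" where
  "controllability_matrix P Q A =
     (\<chi> i c. (matpow (Q ** A ** Q) (to_nat_on (UNIV :: 'n set) (fst c)) ** (Q ** A ** P)) $ i $ snd c)"

lemma columns_controllability_matrix:
  fixes P Q A :: "real^'n^'n"
  shows "columns (controllability_matrix P Q A) =
    (\<Union>k<CARD('n). columns (matpow (Q ** A ** Q) k ** (Q ** A ** P)))"
proof -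
  let ?M = "\<lambda>k. matpow (Q ** A ** Q) k ** (Q ** A ** P)"
  have r: "range (to_nat_on (UNIV :: 'n set)) = {..<CARD('n)}"
    using to_nat_on_finite[OF finite_class.finite_UNIV] unfolding bij_betw_def by (rule conjunct2)
  have c: "column c (controllability_matrix P Q A) =
      column (snd c) (?M (to_nat_on (UNIV :: 'n set) (fst c)))" for c
    unfolding column_def controllability_matrix_def by (simp only: vec_lambda_beta)
  have "columns (controllability_matrix P Q A) =
      (\<Union>a. columns (?M (to_nat_on (UNIV :: 'n set) a)))"
    unfolding columns_def c by force
  also have "\<dots> = (\<Union>k\<in>range (to_nat_on (UNIV :: 'n set)). columns (?M k))"
    by blast
  finally show ?thesis
    unfolding r .
qed

text \<open>Classical solutions of \<open>x' t = R (x t) + B (x t) u t\<close> on \<open>{t0..t1}\<close>, with one-sided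
  derivatives at the end points.\<close>

definition solves_controlled ::
  "(real^'n \<Rightarrow> real^'n) \<Rightarrow> (real^'n \<Rightarrow> real^'p^'n) \<Rightarrow> real \<Rightarrow> real \<Rightarrow>
   (real \<Rightarrow> real^'p) \<Rightarrow> (real \<Rightarrow> real^'n) \<Rightarrow> bool" where
  "solves_controlled R B t0 t1 u x \<longleftrightarrow>
     (\<forall>t\<in>{t0..t1}. (x has_vector_derivative (R (x t) + B (x t) *v u t)) (at t within {t0..t1}))"

definition controllable :: "(real^'n \<Rightarrow> real^'n) \<Rightarrow> (real^'n \<Rightarrow> real^'p^'n) \<Rightarrow> bool" where
  "controllable R B \<longleftrightarrow>
     (\<forall>t0 t1 x0 x1. t0 < t1 \<longrightarrow>
        (\<exists>u x. solves_controlled R B t0 t1 u x \<and> x t0 = x0 \<and> x t1 = x1))"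

end

theory Submission
  imports Defs "HOL-Computational_Algebra.Polynomial"
begin

text \<open>
  Only the component of the state equation in the range of \<open>Q\<close> restricts the motion: once a
  differentiable curve satisfies \<open>Q x' = Q R(x)\<close>, the control \<open>u = B\<^sup>+(x) (x' - R(x))\<close>
  turns it into a solution, because \<open>B u = P (x' - R(x)) = x' - R(x)\<close>. By the linearizing
  assumption the restriction reads \<open>Q x' = Q A x + Q b\<close>, which is affine with constant
  coefficients even for nonlinear \<open>R\<close> and varying \<open>B\<close>. So it suffices to
  join any two states by a curve obeying this equation.

  The rank condition makes the columns of the controllability matrix span the whole range of
  \<open>Q\<close>. It is used twice. All these columns lie in the range of \<open>Q A\<close>, so there is an
  equilibrium \<open>x\<^sub>e\<close> with \<open>Q A x\<^sub>e + Q b = 0\<close>, and moving the origin there removes the constant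
  term. The remaining deviation is written \<open>Q z + P w\<close>, where
  \<open>z' = M z + N w\<close> with \<open>M = Q A Q\<close> and \<open>N = Q A P\<close>: the part \<open>w\<close> of the state acts as an
  input of a Kalman system. Unlike an ordinary input it must be differentiable and take
  prescribed values at both ends, since it is itself part of the state.

  Such a transfer is given by explicit polynomials instead of a Gramian (lemma
  \<open>steer_linear_system\<close>). By superposition one input
  direction \<open>g\<close> at a time is enough. Since \<open>M\<^sup>n g\<close> is a combination of the vectors
  \<open>M\<^sup>k g\<close> with \<open>k < n\<close>, the ansatz \<open>z = \<Sum>k<n. \<zeta>\<^sub>k M\<^sup>k g\<close> turns the equation into a scalar
  chain in which the last coefficient \<open>\<phi> = \<zeta>\<^sub>n\<^sub>-\<^sub>1\<close> is free and determines the others and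
  the input by repeated differentiation. The values of all of them at both end
  times can be prescribed by choosing the polynomial \<open>\<phi>\<close> suitably, which is a form of Hermite
  interpolation (lemma \<open>backward_chain_interpolation\<close>).
\<close>

section \<open>Interpolation along a chain of derivatives\<close>

text \<open>The \<open>i\<close>-th entry is a monic differential operator of order \<open>i\<close> with constant coefficients,
  applied to \<open>\<phi>\<close>. The recursion solves a single-input system in companion form
  from its last coordinate \<open>\<phi>\<close> back to its input.\<close>

primrec backward_chain :: "(nat \<Rightarrow> real) \<Rightarrow> real poly \<Rightarrow> nat \<Rightarrow> real poly" where
  "backward_chain c \<phi> 0 = \<phi>"
| "backward_chain c \<phi> (Suc i) = pderiv (backward_chain c \<phi> i) - smult (c i) \<phi>"

lemma backward_chain_add: "backward_chain c (\<phi> + \<psi>) i = backward_chain c \<phi> i + backward_chain c \<psi> i"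
  by (induction i) (simp_all add: pderiv_add smult_add_right)

text \<open>Each differentiation removes one factor \<open>w\<close> and, by the Leibniz rule, leaves behind
  a factor \<open>w'\<close> times the current exponent; every other contribution is still a multiple of \<open>w\<close>.
  With \<open>i < N\<close> this shows that the chain vanishes at the roots of \<open>w\<close>, and with \<open>i = N\<close> it gives the
  first value there that can be nonzero.\<close>

lemma backward_chain_power_mult:
  assumes "i \<le> N"
  shows "\<exists>r. backward_chain c (w ^ N * q) i = w ^ (N - i) * r \<and>
             (\<forall>s. poly w s = 0 \<longrightarrow>
               poly r s = (\<Prod>l<i. real (N - l)) * poly (pderiv w) s ^ i * poly q s)"
  using assms
proof (induction i)
  case 0
  show ?case by (intro exI[of _ q]) simp
next
  case (Suc i)
  then obtain r where r: "backward_chain c (w ^ N * q) i = w ^ (N - i) * r"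
    and at_roots: "\<And>s. poly w s = 0 \<Longrightarrow>
      poly r s = (\<Prod>l<i. real (N - l)) * poly (pderiv w) s ^ i * poly q s"
    by auto
  define m where "m = N - Suc i"
  have m: "N - i = Suc m" "N = m + Suc i"
    using Suc.prems by (auto simp: m_def)
  define r' where "r' = smult (real (Suc m)) (pderiv w * r) + w * pderiv r - smult (c i) (w ^ Suc i * q)"
  have "backward_chain c (w ^ N * q) (Suc i) = pderiv (w ^ Suc m * r) - smult (c i) (w ^ N * q)"
    by (simp only: backward_chain.simps r m(1))
  also have "\<dots> = w ^ m * r'"
    unfolding r'_def pderiv_mult pderiv_power_Suc m(2) power_add
    by (simp add: algebra_simps smult_add_left)
  finally have "backward_chain c (w ^ N * q) (Suc i) = w ^ m * r'" .
  moreover have "poly r' s = (\<Prod>l<Suc i. real (N - l)) * poly (pderiv w) s ^ Suc i * poly q s"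
    if "poly w s = 0" for s
    using at_roots[OF that] that by (simp add: r'_def m(1))
  ultimately show ?case
    unfolding m_def by blast
qed

text \<open>Induction on the order. Adding \<open>((t - t\<^sub>0) (t - t\<^sub>1))\<^bsup>N+1\<^esup> q(t)\<close> to the polynomial
  leaves the entries up to \<open>N\<close> unchanged at both points and changes entry \<open>N + 1\<close> by a nonzero
  multiple of \<open>q\<close>; an affine \<open>q\<close> can correct both values at once.\<close>

lemma backward_chain_interpolation:
  fixes t0 t1 :: real
  assumes "t0 \<noteq> t1"
  shows "\<exists>\<phi>. \<forall>i\<le>N. poly (backward_chain c \<phi> i) t0 = \<alpha> i \<and> poly (backward_chain c \<phi> i) t1 = \<beta> i"
proof -
  have line: "\<exists>q. poly q t0 = a \<and> poly q t1 = b" for a b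
  proof -
    define \<sigma> where "\<sigma> = (b - a) / (t1 - t0)"
    have "\<sigma> * (t1 - t0) = b - a"
      using assms by (simp add: \<sigma>_def)
    then show ?thesis
      by (intro exI[of _ "[:a - t0 * \<sigma>, \<sigma>:]"]) (simp add: algebra_simps)
  qed
  show ?thesis
  proof (induction N)
    case 0
    show ?case using line[of "\<alpha> 0" "\<beta> 0"] by simp
  next
    case (Suc N)
    then obtain \<phi> where \<phi>: "\<And>i. i \<le> N \<Longrightarrow> poly (backward_chain c \<phi> i) t0 = \<alpha> i \<and> poly (backward_chain c \<phi> i) t1 = \<beta> i"
      by blast
    define w where "w = [:- t0, 1:] * [:- t1, 1:]"
    have w: "poly w t0 = 0" "poly w t1 = 0"
      and w': "poly (pderiv w) t0 \<noteq> 0" "poly (pderiv w) t1 \<noteq> 0"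
      using assms by (simp_all add: w_def pderiv_mult pderiv_pCons)
    define \<kappa> where "\<kappa> s = (\<Prod>l<Suc N. real (Suc N - l)) * poly (pderiv w) s ^ Suc N" for s
    have \<kappa>: "\<kappa> t0 \<noteq> 0" "\<kappa> t1 \<noteq> 0"
      using w' by (auto simp: \<kappa>_def)
    obtain q where q: "poly q t0 = (\<alpha> (Suc N) - poly (backward_chain c \<phi> (Suc N)) t0) / \<kappa> t0"
        "poly q t1 = (\<beta> (Suc N) - poly (backward_chain c \<phi> (Suc N)) t1) / \<kappa> t1"
      using line by blast
    let ?\<rho> = "w ^ Suc N * q"
    have low: "poly (backward_chain c ?\<rho> i) s = 0" if "i \<le> N" "poly w s = 0" for i s
      using backward_chain_power_mult[of i "Suc N" c w q] that by (auto simp: power_0_left)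
    have top: "poly (backward_chain c ?\<rho> (Suc N)) s = \<kappa> s * poly q s" if "poly w s = 0" for s
      using backward_chain_power_mult[of "Suc N" "Suc N" c w q] that by (auto simp: \<kappa>_def)
    show ?case
    proof (intro exI[of _ "\<phi> + ?\<rho>"] allI impI)
      fix i assume "i \<le> Suc N"
      then consider "i \<le> N" | "i = Suc N" by linarith
      then show "poly (backward_chain c (\<phi> + ?\<rho>) i) t0 = \<alpha> i \<and> poly (backward_chain c (\<phi> + ?\<rho>) i) t1 = \<beta> i"
      proof cases
        case 1
        then show ?thesis
          unfolding backward_chain_add poly_add using \<phi> low w by simp
      next
        case 2
        show ?thesis
          unfolding 2 backward_chain_add poly_add top[OF w(1)] top[OF w(2)] q
          using \<kappa> by simp
      qed
    qed
  qed
qed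

section \<open>Krylov sequences\<close>

text \<open>The map \<open>F\<close> need not be injective, so that coefficients can be indexed by powers and columns
  even where the vectors coincide.\<close>

lemma span_image_sum:
  assumes "finite I" "v \<in> span (F ` I)"
  shows "\<exists>u. v = (\<Sum>i\<in>I. u i *\<^sub>R F i)"
  using assms(2)
proof (induction rule: span_induct_alt)
  case base
  show ?case by (intro exI[of _ "\<lambda>_. 0"]) simp
next
  case (step c x y)
  then obtain i u where iu: "i \<in> I" "x = F i" "y = (\<Sum>i\<in>I. u i *\<^sub>R F i)" by auto
  have "c *\<^sub>R x + y = (\<Sum>j\<in>I. (u j + (if j = i then c else 0)) *\<^sub>R F j)"
    using iu assms(1) by (simp add: scaleR_add_left sum.distrib if_distrib[of "\<lambda>r. r *\<^sub>R _"] sum.delta cong: if_cong)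
  then show ?case
    by (intro exI[of _ "\<lambda>j. u j + (if j = i then c else 0)"])
qed

text \<open>This plays the part of the Cayley--Hamilton theorem for a single vector. The dimension of
  the span of the first \<open>d\<close> iterates cannot grow at every step up to \<open>DIM('a) + 1\<close>; and as soon as
  one iterate depends on its predecessors, applying \<open>f\<close> shows the same for all later ones.\<close>

lemma krylov_relation:
  fixes f :: "'a::euclidean_space \<Rightarrow> 'a"
  assumes "linear f"
  shows "\<exists>a. (f ^^ DIM('a)) g = (\<Sum>k<DIM('a). a k *\<^sub>R (f ^^ k) g)"
proof -
  define S where "S d = (\<lambda>k. (f ^^ k) g) ` {..<d}" for d
  have S_Suc: "S (Suc d) = insert ((f ^^ d) g) (S d)" for d
    by (simp add: S_def lessThan_Suc)
  have "\<exists>d\<le>DIM('a). (f ^^ d) g \<in> span (S d)"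
  proof (rule ccontr)
    assume *: "\<not> ?thesis"
    have "d \<le> Suc DIM('a) \<Longrightarrow> dim (S d) = d" for d
    proof (induction d)
      case 0
      show ?case by (simp add: S_def)
    next
      case (Suc d)
      then show ?case using * by (simp add: S_Suc dim_insert)
    qed
    from this[of "Suc DIM('a)"] show False
      using dim_subset_UNIV[of "S (Suc DIM('a))"] by simp
  qed
  then obtain d where d: "d \<le> DIM('a)" "(f ^^ d) g \<in> span (S d)" by blast
  have "(f ^^ k) g \<in> span (S k)" if "d \<le> k" for k
    using that
  proof (induction k rule: dec_induct)
    case base
    show ?case by (rule d)
  next
    case (step k)
    have "f ` S k \<subseteq> S (Suc k)" unfolding S_def by force
    moreover have "(f ^^ Suc k) g \<in> span (f ` S k)"
      using step.IH linear_span_image[OF assms] by auto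
    ultimately show ?case using span_mono by blast
  qed
  from this[OF d(1)] show ?thesis
    unfolding S_def by (rule span_image_sum[OF finite_lessThan])
qed

section \<open>Steering linear systems with smooth inputs of prescribed end values\<close>

text \<open>With \<open>f\<^sup>n g = \<Sum>k<n. a\<^sub>k f\<^sup>k g\<close> and \<open>z = \<Sum>k<n. \<psi>\<^sub>k\<^sub>+\<^sub>1 f\<^sup>k g\<close>, comparing
  coefficients in \<open>z' = f z + w g\<close> gives \<open>\<psi>'\<^sub>k\<^sub>+\<^sub>1 = \<psi>\<^sub>k + a\<^sub>k \<psi>\<^sub>n\<close> with \<open>\<psi>\<^sub>0 = w\<close>. Read from the top
  index downwards this is a backward chain starting from \<open>\<psi>\<^sub>n\<close>, and interpolation along it gives
  both the state coefficients and the input their end values.\<close>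

lemma steer_single_input:
  fixes f :: "'a::euclidean_space \<Rightarrow> 'a"
  assumes "linear f" "t0 \<noteq> t1"
  shows "\<exists>w w' z. (\<forall>t. (w has_vector_derivative w' t) (at t)) \<and>
      (\<forall>t. (z has_vector_derivative (f (z t) + w t *\<^sub>R g)) (at t)) \<and>
      w t0 = \<mu> \<and> w t1 = (\<nu>::real) \<and>
      z t0 = (\<Sum>k<DIM('a). \<alpha> k *\<^sub>R (f ^^ k) g) \<and>
      z t1 = (\<Sum>k<DIM('a). \<beta> k *\<^sub>R (f ^^ k) g)"
proof -
  let ?n = "DIM('a)"
  let ?v = "\<lambda>k. (f ^^ k) g"
  obtain a where a: "?v ?n = (\<Sum>k<?n. a k *\<^sub>R ?v k)"
    using krylov_relation[OF assms(1)] by blast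
  \<comment> \<open>Entry \<open>i\<close> of the chain is \<open>\<psi> (n - i)\<close>, so the coefficients and the data appear in reverse order.\<close>
  define c where "c i = a (?n - 1 - i)" for i
  obtain \<phi> where \<phi>: "\<And>i. i \<le> ?n \<Longrightarrow>
      poly (backward_chain c \<phi> i) t0 = (if i = ?n then \<mu> else \<alpha> (?n - 1 - i)) \<and>
      poly (backward_chain c \<phi> i) t1 = (if i = ?n then \<nu> else \<beta> (?n - 1 - i))"
    using backward_chain_interpolation[OF assms(2), of ?n c
        "\<lambda>i. if i = ?n then \<mu> else \<alpha> (?n - 1 - i)" "\<lambda>i. if i = ?n then \<nu> else \<beta> (?n - 1 - i)"]
    by blast
  define \<psi> where "\<psi> k = backward_chain c \<phi> (?n - k)" for k
  have \<psi>_rec: "pderiv (\<psi> (Suc k)) = \<psi> k + smult (a k) (\<psi> ?n)" if "k < ?n" for k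
  proof -
    have "?n - k = Suc (?n - Suc k)" "?n - 1 - (?n - Suc k) = k"
      using that by auto
    then show ?thesis
      by (simp add: \<psi>_def c_def)
  qed
  define z where "z t = (\<Sum>k<?n. poly (\<psi> (Suc k)) t *\<^sub>R ?v k)" for t
  have z': "(z has_vector_derivative (f (z t) + poly (\<psi> 0) t *\<^sub>R g)) (at t)" for t
  proof -
    have "f (z t) = (\<Sum>k<?n. poly (\<psi> (Suc k)) t *\<^sub>R ?v (Suc k))"
      by (simp add: z_def linear_sum[OF assms(1)] linear_cmul[OF assms(1)])
    then have "f (z t) + poly (\<psi> 0) t *\<^sub>R g = (\<Sum>k<Suc ?n. poly (\<psi> k) t *\<^sub>R ?v k)"
      by (subst sum.lessThan_Suc_shift) simp
    also have "\<dots> = (\<Sum>k<?n. poly (pderiv (\<psi> (Suc k))) t *\<^sub>R ?v k)"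
      using \<psi>_rec by (simp add: a scaleR_sum_right scaleR_add_left sum.distrib mult.commute)
    finally have rhs: "f (z t) + poly (\<psi> 0) t *\<^sub>R g = (\<Sum>k<?n. poly (pderiv (\<psi> (Suc k))) t *\<^sub>R ?v k)" .
    show ?thesis
      unfolding rhs unfolding z_def
      by (auto intro!: derivative_eq_intros poly_DERIV)
  qed
  have "((\<lambda>t. poly (\<psi> 0) t) has_vector_derivative poly (pderiv (\<psi> 0)) t) (at t)" for t
    using poly_DERIV has_real_derivative_iff_has_vector_derivative by blast
  moreover have "poly (\<psi> 0) t0 = \<mu>" "poly (\<psi> 0) t1 = \<nu>"
    using \<phi> by (simp_all add: \<psi>_def)
  moreover have "z t0 = (\<Sum>k<?n. \<alpha> k *\<^sub>R ?v k)" "z t1 = (\<Sum>k<?n. \<beta> k *\<^sub>R ?v k)"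
    unfolding z_def using \<phi> by (auto intro!: sum.cong simp: \<psi>_def)
  ultimately show ?thesis
    using z' by blast
qed

lemma matpow_mult_vec: "matpow M k *v y = (((*v) M) ^^ k) y"
  by (induction k) (simp_all add: matpow_def flip: matrix_vector_mul_assoc)

lemma reachable_combination:
  fixes M :: "real^'n^'n" and N :: "real^'p^'n"
  assumes "v \<in> span (\<Union>k<CARD('n). columns (matpow M k ** N))"
  shows "\<exists>\<alpha>. v = (\<Sum>j\<in>UNIV. \<Sum>k<CARD('n). \<alpha> j k *\<^sub>R (((*v) M) ^^ k) (column j N))"
proof -
  have "(\<Union>k<CARD('n). columns (matpow M k ** N)) =
      (\<lambda>(j, k). (((*v) M) ^^ k) (column j N)) ` (UNIV \<times> {..<CARD('n)})"
    by (force simp: columns_def matrix_vector_mult_basis[symmetric] matpow_mult_vec[symmetric] matrix_vector_mul_assoc)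
  then obtain u where "v = (\<Sum>(j, k)\<in>UNIV \<times> {..<CARD('n)}. u (j, k) *\<^sub>R (((*v) M) ^^ k) (column j N))"
    using span_image_sum[of "UNIV \<times> {..<CARD('n)}" v "\<lambda>(j, k). (((*v) M) ^^ k) (column j N)"] assms
    by (auto simp: case_prod_unfold)
  then show ?thesis
    by (intro exI[of _ "\<lambda>j k. u (j, k)"]) (simp add: sum.cartesian_product)
qed

text \<open>Superposition: every column of \<open>N\<close> is driven by its own scalar input, and the end values of
  \<open>z\<close> are distributed over the columns by their coefficients as Krylov combinations.\<close>

lemma steer_linear_system:
  fixes M :: "real^'n^'n" and N :: "real^'p^'n"
  assumes "t0 \<noteq> t1"
    and "z0 \<in> span (\<Union>k<CARD('n). columns (matpow M k ** N))"
    and "z1 \<in> span (\<Union>k<CARD('n). columns (matpow M k ** N))"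
  shows "\<exists>w w' z. (\<forall>t. (w has_vector_derivative w' t) (at t)) \<and>
      (\<forall>t. (z has_vector_derivative (M *v z t + N *v w t)) (at t)) \<and>
      w t0 = w0 \<and> w t1 = w1 \<and> z t0 = z0 \<and> z t1 = z1"
proof -
  obtain \<alpha> where \<alpha>: "z0 = (\<Sum>j\<in>UNIV. \<Sum>k<CARD('n). \<alpha> j k *\<^sub>R (((*v) M) ^^ k) (column j N))"
    using reachable_combination[OF assms(2)] by blast
  obtain \<beta> where \<beta>: "z1 = (\<Sum>j\<in>UNIV. \<Sum>k<CARD('n). \<beta> j k *\<^sub>R (((*v) M) ^^ k) (column j N))"
    using reachable_combination[OF assms(3)] by blast
  define steers where "steers j w w' z \<longleftrightarrow>
      (\<forall>t. (w has_vector_derivative w' t) (at t)) \<and>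
      (\<forall>t. (z has_vector_derivative (M *v z t + w t *\<^sub>R column j N)) (at t)) \<and>
      w t0 = w0 $ j \<and> w t1 = w1 $ j \<and>
      z t0 = (\<Sum>k<CARD('n). \<alpha> j k *\<^sub>R (((*v) M) ^^ k) (column j N)) \<and>
      z t1 = (\<Sum>k<CARD('n). \<beta> j k *\<^sub>R (((*v) M) ^^ k) (column j N))" for j w w' z
  have "\<forall>j. \<exists>w w' z. steers j w w' z"
    using steer_single_input[OF matrix_vector_mul_linear assms(1), of M]
    by (simp add: steers_def)
  then obtain w w' z where steers: "\<And>j. steers j (w j) (w' j) (z j)"
    by metis
  then have w': "(w j has_vector_derivative w' j t) (at t)"
    and z': "(z j has_vector_derivative (M *v z j t + w j t *\<^sub>R column j N)) (at t)" for j t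
    by (auto simp: steers_def)
  define W where "W t = (\<Sum>j\<in>UNIV. w j t *\<^sub>R axis j (1::real))" for t
  define Z where "Z t = (\<Sum>j\<in>UNIV. z j t)" for t
  have "(W has_vector_derivative (\<Sum>j\<in>UNIV. w' j t *\<^sub>R axis j 1)) (at t)" for t
    unfolding W_def
    by (intro has_vector_derivative_sum
        bounded_linear.has_vector_derivative[OF bounded_linear_scaleR_left] w')
  moreover have "(Z has_vector_derivative (M *v Z t + N *v W t)) (at t)" for t
  proof -
    have "M *v Z t + N *v W t = (\<Sum>j\<in>UNIV. M *v z j t + w j t *\<^sub>R column j N)"
      by (simp add: Z_def W_def sum.distrib linear_sum[OF matrix_vector_mul_linear]
          linear_cmul[OF matrix_vector_mul_linear] matrix_vector_mult_basis)
    then show ?thesis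
      unfolding Z_def by (auto intro!: has_vector_derivative_sum z' simp: Z_def)
  qed
  moreover have "W t0 = w0" "W t1 = w1"
    using steers basis_expansion[of w0] basis_expansion[of w1]
    by (simp_all add: W_def steers_def scalar_mult_eq_scaleR)
  moreover have "Z t0 = z0" "Z t1 = z1"
    using steers by (simp_all add: Z_def steers_def \<alpha> \<beta>)
  ultimately show ?thesis
    by (intro exI[of _ W] exI[of _ "\<lambda>t. \<Sum>j\<in>UNIV. w' j t *\<^sub>R axis j 1"] exI[of _ Z])
      blast
qed

section \<open>Projectors and the rank condition\<close>

text \<open>Full column rank makes the Gram matrix \<open>B\<^sup>T B\<close> invertible, because
  \<open>v \<bullet> B\<^sup>T B v\<close> is the squared norm of \<open>B v\<close>.\<close>

lemma left_pinv_mult: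
  fixes B :: "real^'p^'n"
  assumes "rank B = CARD('p)"
  shows "left_pinv B ** B = mat 1"
proof -
  let ?G = "transpose B ** B"
  have inj: "inj ((*v) B)"
    using assms full_rank_injective by blast
  have "v = 0" if "?G *v v = 0" for v
  proof -
    have "(B *v v) \<bullet> (B *v v) = v \<bullet> (?G *v v)"
      by (metis dot_lmul_matrix inner_commute matrix_vector_mul_assoc transpose_matrix_vector)
    then have "B *v v = B *v 0"
      using that by simp
    then show "v = 0"
      by (rule inj_onD[OF inj]) auto
  qed
  then have "invertible ?G"
    by (meson invertible_left_inverse matrix_left_invertible_ker)
  then have "matrix_inv ?G ** ?G = mat 1"
    unfolding invertible_def matrix_inv_def by (rule someI2_ex) blast
  then show ?thesis
    by (simp add: left_pinv_def matrix_mul_assoc)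
qed

text \<open>The rows of \<open>Q\<close> are orthogonal to the range of \<open>B\<close>, so they lie in its orthogonal
  complement.\<close>

lemma rank_le_of_annihilates:
  fixes Q :: "real^'n^'m" and B :: "real^'p^'n"
  assumes "Q ** B = 0"
  shows "rank Q \<le> CARD('n) - rank B"
proof -
  let ?S = "range ((*v) B)"
  have "rows Q \<subseteq> {y \<in> UNIV. \<forall>x\<in>?S. orthogonal x y}"
  proof -
    have "orthogonal (B *v v) (row i Q)" for v i
    proof -
      have "row i Q \<bullet> (B *v v) = (Q *v (B *v v)) $ i"
        by (simp add: matrix_mult_dot row_def)
      then show ?thesis
        by (simp add: matrix_vector_mul_assoc assms orthogonal_def inner_commute)
    qed
    then show ?thesis by (auto simp: rows_def)
  qed
  then have "rank Q \<le> dim {y \<in> UNIV. \<forall>x\<in>?S. orthogonal x y}"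
    unfolding row_rank_def by (rule dim_subset)
  moreover have "dim {y \<in> UNIV. \<forall>x\<in>?S. orthogonal x y} + dim ?S = dim (UNIV :: (real^'n) set)"
    by (rule dim_subspace_orthogonal_to_vectors)
      (auto intro: linear_subspace_image)
  ultimately show ?thesis
    by (simp add: rank_dim_range)
qed

text \<open>All columns lie in the range of \<open>Q\<close> since every block starts with a factor \<open>Q\<close>, also the
  block with power \<open>0\<close>; the rank hypothesis leaves no room for a proper subspace.\<close>

lemma span_controllability_columns:
  fixes P Q A :: "real^'n^'n"
  assumes "Q ** Q = Q" and "rank Q \<le> rank (controllability_matrix P Q A)"
  shows "span (columns (controllability_matrix P Q A)) = range ((*v) Q)"
proof -
  let ?K = "columns (controllability_matrix P Q A)"
  have QQ: "Q *v (Q *v v) = Q *v v" for v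
    by (simp add: matrix_vector_mul_assoc assms(1))
  have "Q *v (matpow (Q ** A ** Q) k *v ((Q ** A ** P) *v e)) =
      matpow (Q ** A ** Q) k *v ((Q ** A ** P) *v e)" for k e
    by (cases k) (simp_all add: matpow_mult_vec QQ flip: matrix_vector_mul_assoc)
  then have "(matpow (Q ** A ** Q) k ** (Q ** A ** P)) *v e \<in> range ((*v) Q)" for k e
    by (metis matrix_vector_mul_assoc rangeI)
  then have "?K \<subseteq> range ((*v) Q)"
    unfolding columns_controllability_matrix by (auto simp: columns_image_basis)
  then have sub: "span ?K \<subseteq> range ((*v) Q)"
    by (intro span_minimal) (auto intro: linear_subspace_image)
  moreover have "dim (range ((*v) Q)) \<le> dim (span ?K)"
    using assms(2) by (simp add: rank_dim_range[of Q] column_rank_def[of "controllability_matrix P Q A"])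
  ultimately show ?thesis
    by (intro subspace_dim_equal) (auto intro: linear_subspace_image)
qed

section \<open>Controllability under the linearizing assumption\<close>

theorem theorem5:
  fixes R :: "real^'n \<Rightarrow> real^'n"
    and B :: "real^'n \<Rightarrow> real^'p^'n"
    and h :: "real^'n \<Rightarrow> real^'m"
    and P Q A :: "real^'n^'n"
    and b :: "real^'n"
    and C :: "real^'n^'m"
  assumes "CARD('p) \<le> CARD('n)"
    and "CARD('m) \<le> CARD('n)"
    and "\<forall>x. rank (B x) = CARD('p)"
    and "linearizing_assumption R B h P Q A b C"
    and "rank (controllability_matrix P Q A) = CARD('n) - CARD('p)"
  shows "controllable R B"
proof -
  have P: "\<And>x. P = B x ** left_pinv (B x)" and Q: "Q = mat 1 - P"
    and QR: "\<And>x. Q *v R x = (Q ** A) *v x + Q *v b"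
    using assms(4) by (auto simp: linearizing_assumption_def proj_P_def)
  have PB: "P ** B x = B x" for x
    using left_pinv_mult[of "B x"] assms(3) P[of x]
    by (metis matrix_mul_assoc matrix_mul_rid)
  have PP: "P ** P = P"
    using P PB by (metis matrix_mul_assoc)
  have split: "Q *v v + P *v v = v" for v
    by (simp add: Q matrix_vector_mult_diff_rdistrib)
  have PP_vec: "P *v (P *v v) = P *v v" for v
    by (simp add: matrix_vector_mul_assoc PP)
  have QP_vec: "Q *v (P *v v) = 0" and QQ_vec: "Q *v (Q *v v) = Q *v v" for v
    by (simp_all add: Q matrix_vector_mult_diff_rdistrib matrix_vector_mult_diff_distrib PP_vec)
  have QQ: "Q ** Q = Q"
    using QQ_vec by (simp add: matrix_eq flip: matrix_vector_mul_assoc)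
  have QB: "Q ** B x = 0" for x
  proof -
    have "Q *v (B x *v v) = 0" for v
      unfolding Q matrix_vector_mult_diff_rdistrib by (simp add: matrix_vector_mul_assoc PB)
    then show ?thesis
      by (simp add: matrix_eq matrix_vector_mul_assoc)
  qed
  let ?M = "Q ** A ** Q" and ?N = "Q ** A ** P"
  let ?K = "\<Union>k<CARD('n). columns (matpow ?M k ** ?N)"
  have "rank Q \<le> rank (controllability_matrix P Q A)"
    using rank_le_of_annihilates[OF QB] assms(3,5) by auto
  from span_controllability_columns[OF QQ this]
  have span_K: "span ?K = range ((*v) Q)"
    by (simp add: columns_controllability_matrix)

  \<comment> \<open>Every column of the controllability matrix lies in the range of \<open>Q ** A\<close>; as these columns
    span the range of \<open>Q\<close>, the constant term can be balanced by an equilibrium.\<close>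
  obtain xe where xe: "Q *v (A *v xe) + Q *v b = 0"
  proof -
    have "matpow ?M k *v (?N *v v) \<in> range ((*v) (Q ** A))" for k v
      by (cases k) (auto simp: matpow_mult_vec simp flip: matrix_vector_mul_assoc)
    then have "(matpow ?M k ** ?N) *v v \<in> range ((*v) (Q ** A))" for k v
      by (metis matrix_vector_mul_assoc)
    then have "?K \<subseteq> range ((*v) (Q ** A))"
      by (auto simp: columns_image_basis)
    then have "span ?K \<subseteq> range ((*v) (Q ** A))"
      by (intro span_minimal) (auto intro: linear_subspace_image)
    then have "Q *v (- b) \<in> range ((*v) (Q ** A))"
      using span_K by auto
    then obtain xe where "Q *v (- b) = (Q ** A) *v xe" by blast
    moreover have "Q *v (- b) + Q *v b = 0"
      by (simp flip: matrix_vector_right_distrib)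
    ultimately show thesis
      by (intro that[of xe]) (simp add: matrix_vector_mul_assoc)
  qed

  show ?thesis
    unfolding controllable_def
  proof (intro allI impI)
    fix t0 t1 :: real and x0 x1 :: "real^'n"
    assume "t0 < t1"
    obtain w w' z where
      w': "\<And>t. (w has_vector_derivative w' t) (at t)" and
      z': "\<And>t. (z has_vector_derivative (?M *v z t + ?N *v w t)) (at t)" and
      ends: "w t0 = x0 - xe" "w t1 = x1 - xe" "z t0 = Q *v (x0 - xe)" "z t1 = Q *v (x1 - xe)"
      using steer_linear_system[of t0 t1 "Q *v (x0 - xe)" ?M ?N "Q *v (x1 - xe)" "x0 - xe" "x1 - xe"]
        \<open>t0 < t1\<close> unfolding span_K by blast
    \<comment> \<open>Projecting \<open>z\<close> by \<open>Q\<close> and \<open>w\<close> by \<open>P\<close> does not affect their equation, since \<open>M\<close> and \<open>N\<close>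
      contain these factors, and makes the two parts complementary.\<close>
    define x where "x t = xe + (Q *v z t + P *v w t)" for t
    define x' where "x' t = Q *v (?M *v z t + ?N *v w t) + P *v w' t" for t
    define u where "u t = left_pinv (B (x t)) *v (x' t - R (x t))" for t
    have deriv: "(x has_vector_derivative x' t) (at t)" for t
      unfolding x_def x'_def
      by (auto intro!: derivative_eq_intros
          bounded_linear.has_vector_derivative[OF matrix_vector_mul_bounded_linear] w' z')
    have constraint: "Q *v x' t = Q *v R (x t)" for t
    proof -
      have "Q *v x' t = Q *v (A *v (Q *v z t + P *v w t))"
        by (simp add: x'_def QQ_vec QP_vec matrix_vector_right_distrib flip: matrix_vector_mul_assoc)
      also have "\<dots> = Q *v (A *v x t) + Q *v b"
        using xe by (simp add: x_def matrix_vector_right_distrib algebra_simps)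
      finally show ?thesis
        by (simp add: QR matrix_vector_mul_assoc)
    qed
    have "R (x t) + B (x t) *v u t = x' t" for t
    proof -
      have "B (x t) *v u t = P *v (x' t - R (x t))"
        by (simp add: u_def P[of "x t", symmetric] matrix_vector_mul_assoc)
      also have "\<dots> = x' t - R (x t)"
        using split[of "x' t - R (x t)"] constraint[of t] by (simp add: matrix_vector_mult_diff_distrib)
      finally show ?thesis by simp
    qed
    then have "solves_controlled R B t0 t1 u x"
      unfolding solves_controlled_def using deriv by (simp add: has_vector_derivative_at_within)
    moreover have "x t0 = x0" "x t1 = x1"
      by (simp_all add: x_def ends QQ_vec split)
    ultimately show "\<exists>u x. solves_controlled R B t0 t1 u x \<and> x t0 = x0 \<and> x t1 = x1"
      by blast
  qed
qed

end
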